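(* Let $n\ge 1$, $t_f>0$, let $\omega_i>0$ and $d_i<0$ ($i=1,\dots,n$) and $\tilde\omega_i>0$ ($i=3,\dots,n$) be real constants. Let $x_0(0)>x_1(0)>\cdots>x_n(0)$ be real numbers and put $y_i(0)=x_i(0)-x_{i-1}(0)$. Consider the $n$-player noncooperative differential game in which player $i$ ($i=1,\dots,n$) chooses $u_i$ to minimize $$J_i(y_i,y_{i-1},u_i)=\frac12\int_0^{t_f}\Big(\omega_i(y_i-d_i)^2+\tilde\omega_i\big((y_i-d_i)+(y_{i-1}-d_{i-1})\big)^2+u_i^2\Big)\,dt$$ (the term with $\tilde\omega_i$ being absent for $i=1,2$) subject to $\dot y_i=u_i$ with the given initial value $y_i(0)$. Then: 1. There is a unique Nash equilibrium. 2. The relative displacement trajectories associated with the Nash equilibrium are $$y_i(t)=\begin{cases}\alpha_i^i(t)\,y_i(0)+(\alpha_i^i(t)-1)\,d_i, & i=1,2,\\[4pt] \displaystyle\sum_{k=2}^{i}\alpha_k^i(t)\,y_k(0)+\sum_{k=2}^{i-1}\alpha_k^i(t)\,d_k+(\alpha_i^i(t)-1)\,d_i, & i=3,\dots,n,\end{cases}$$ where $$\alpha_i^i(t)=\begin{cases}\dfrac{\cosh(\sqrt{\omega_i}(t_f-t))}{\cosh(\sqrt{\omega_i}\,t_f)}, & i=1,2,\\[8pt] \dfrac{\cosh(\sqrt{\tilde\omega_i+\omega_i}\,(t_f-t))}{\cosh(\sqrt{\tilde\omega_i+\omega_i}\;t_f)}, & i=3,\dots,n,\end{cases}$$ and $$\alpha_i^j(t)=\sum_{k=i}^{j}\eta_k^j\,\zeta_i^k\,\alpha_k^k(t),\qquad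 i\neq j,\ i=2,\dots,n,\ j=3,\dots,n$$ (an empty sum, for $i>j$, being zero), with the coefficients $\eta_k^j,\zeta_i^k$ given in the context.
   Context: Superscripts on $\alpha,\eta,\zeta$ are indices, not powers. Strategies are open-loop: player $i$'s strategy is a function $u_i\in L^2([0,t_f];\mathbb{R})$, and the corresponding trajectory is $y_i(t)=y_i(0)+\int_0^t u_i(s)\,ds$, $t\in[0,t_f]$. A Nash equilibrium is a profile $(u_1,\dots,u_n)$ such that, for every $i$, no unilateral change of $u_i$ (the other players' controls being kept fixed) yields a smaller value of $J_i$. Uniqueness is understood up to equality almost everywhere. (Interpretation: $y_i=x_i-x_{i-1}$ is the relative displacement of vehicle $i$ with respect to its predecessor, $d_i$ the inter-vehicle distancing policy; each vehicle from the third on also uses information from its second predecessor.) Coefficients: put $\delta_i=\omega_i$ for $i=1,2$ and $\delta_i=\tilde\omega_i+\omega_i$ for $i=3,\dots,n$. Take nonzero reals $\eta_1^1,\dots,\eta_n^n$ and, for $2\le i<j\le n$, put recursively $$\eta_i^j=-\frac{\tilde\omega_j\,\eta_i^{j-1}}{\tilde\omega_j+\omega_j-\delta_i}.$$ Put $\zeta_i^i=1/\eta_i^i$ for all $i$ and, for $2\le i\le n-1$, $$\zeta_i^{i+1}=\frac{\tilde\omega_{i+1}-\eta_i^{i+1}\zeta_i^i\delta_i}{\eta_{i+1}^{i+1}\delta_{i+1}},\qquad \zeta_i^{j}=-\frac{\sum_{k=i}^{j-1}\eta_k^{j}\,\zeta_i^{k}\,\delta_k}{\eta_j^j\delta_j}\quad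 (j=i+2,\dots,n).$$ These are the entries of $V$ and $V^{-1}$ in the factorization $A=V\,\mathrm{diag}(\delta_1,\dots,\delta_n)\,V^{-1}$ of the lower bidiagonal matrix $A$ with diagonal $\delta_1,\dots,\delta_n$ and subdiagonal entries $A_{21}=0$, $A_{i,i-1}=\tilde\omega_i$ for $i\ge3$: $\eta_i^j$ is the $j$-th component of the $i$-th column of $V$, $\zeta_i^j$ the $j$-th component of the $i$-th column of $V^{-1}$.
   Formalization: All d-terms in the formula for y_i(t) are given the opposite sign (minus instead of plus), since the printed signs fail already for n=1; and the formula for y_i is claimed only when δ_2,…,δ_i are distinct, as otherwise some η_k^j divides by zero. *)

theory Defs
  imports "HOL-Analysis.Analysis"
begin

text \<open>
  Players are indexed by \<open>1, \<dots>, n\<close>. A strategy profile is a function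
  \<open>u :: nat \<Rightarrow> real \<Rightarrow> real\<close>, of which only the components \<open>u 1, \<dots>, u n\<close>, restricted to
  the time interval \<open>{0..tf}\<close>, are relevant. The parameter functions \<open>w\<close> and \<open>wt\<close> are the
  weights \<open>\<omega>\<close> and \<open>\<omega>\<close> with a tilde; \<open>wt i\<close> is used only for \<open>i \<ge> 3\<close>.
\<close>

definition L2 :: "real \<Rightarrow> (real \<Rightarrow> real) set" where
  "L2 tf = {u. u \<in> borel_measurable (lebesgue_on {0..tf}) \<and>
               integrable (lebesgue_on {0..tf}) (\<lambda>t. (u t)\<^sup>2)}"

definition traj :: "real \<Rightarrow> (real \<Rightarrow> real) \<Rightarrow> real \<Rightarrow> real" where
  "traj y0 u t = y0 + (LINT s:{0..t}|lebesgue. u s)"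

definition cost ::
  "real \<Rightarrow> (nat \<Rightarrow> real) \<Rightarrow> (nat \<Rightarrow> real) \<Rightarrow> (nat \<Rightarrow> real) \<Rightarrow> nat \<Rightarrow>
   (real \<Rightarrow> real) \<Rightarrow> (real \<Rightarrow> real) \<Rightarrow> (real \<Rightarrow> real) \<Rightarrow> real" where
  "cost tf w wt d i y yp u =
     1 / 2 * (LINT t:{0..tf}|lebesgue.
       w i * (y t - d i)\<^sup>2
       + (if i \<ge> 3 then wt i * ((y t - d i) + (yp t - d (i - 1)))\<^sup>2 else 0)
       + (u t)\<^sup>2)"

text \<open>
  For \<open>i = 1\<close> the second trajectory argument of \<open>cost\<close> is the meaningless \<open>traj (y0 0) (u 0)\<close>,
  but \<open>cost\<close> ignores that argument for \<open>i < 3\<close>.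
\<close>

definition player_cost ::
  "real \<Rightarrow> (nat \<Rightarrow> real) \<Rightarrow> (nat \<Rightarrow> real) \<Rightarrow> (nat \<Rightarrow> real) \<Rightarrow> (nat \<Rightarrow> real) \<Rightarrow>
   nat \<Rightarrow> (nat \<Rightarrow> real \<Rightarrow> real) \<Rightarrow> real" where
  "player_cost tf w wt d y0 i u =
     cost tf w wt d i (traj (y0 i) (u i)) (traj (y0 (i - 1)) (u (i - 1))) (u i)"

definition nash_equilibrium ::
  "nat \<Rightarrow> real \<Rightarrow> (nat \<Rightarrow> real) \<Rightarrow> (nat \<Rightarrow> real) \<Rightarrow> (nat \<Rightarrow> real) \<Rightarrow> (nat \<Rightarrow> real) \<Rightarrow>
   (nat \<Rightarrow> real \<Rightarrow> real) \<Rightarrow> bool" where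
  "nash_equilibrium n tf w wt d y0 u \<longleftrightarrow>
     (\<forall>i\<in>{1..n}. u i \<in> L2 tf) \<and>
     (\<forall>i\<in>{1..n}. \<forall>v\<in>L2 tf.
        player_cost tf w wt d y0 i u \<le> player_cost tf w wt d y0 i (u(i := v)))"

definition delta :: "(nat \<Rightarrow> real) \<Rightarrow> (nat \<Rightarrow> real) \<Rightarrow> nat \<Rightarrow> real" where
  "delta w wt i = (if i \<ge> 3 then wt i + w i else w i)"

text \<open>
  \<open>eta w wt e i j\<close> is \<open>\<eta>\<^sub>i\<close> with upper index \<open>j\<close>, the \<open>j\<close>-th component of an eigenvector
  for \<open>\<delta>\<^sub>i\<close>; the argument \<open>e\<close> supplies the freely chosen diagonal entries. Likewise
  \<open>zeta w wt e i j\<close> is the \<open>j\<close>-th component of the \<open>i\<close>-th column of the inverse matrix.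
  Both matrices are lower triangular and their first columns vanish below the diagonal.
  The recursion for \<open>eta\<close> divides by \<open>\<delta>\<^sub>j - \<delta>\<^sub>i\<close> and is meaningful only where these differ.
\<close>

fun eta :: "(nat \<Rightarrow> real) \<Rightarrow> (nat \<Rightarrow> real) \<Rightarrow> (nat \<Rightarrow> real) \<Rightarrow> nat \<Rightarrow> nat \<Rightarrow> real" where
  "eta w wt e i j =
     (if j = i then e i
      else if 2 \<le> i \<and> i < j
        then - (wt j * eta w wt e i (j - 1)) / (wt j + w j - delta w wt i)
      else 0)"

declare eta.simps [simp del]

fun zeta :: "(nat \<Rightarrow> real) \<Rightarrow> (nat \<Rightarrow> real) \<Rightarrow> (nat \<Rightarrow> real) \<Rightarrow> nat \<Rightarrow> nat \<Rightarrow> real" where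
  "zeta w wt e i j =
     (if j = i then 1 / eta w wt e i i
      else if 2 \<le> i \<and> j = i + 1
        then (wt j - eta w wt e i j * zeta w wt e i i * delta w wt i)
             / (eta w wt e j j * delta w wt j)
      else if 2 \<le> i \<and> i + 2 \<le> j
        then - (\<Sum>k = i..<j. eta w wt e k j * zeta w wt e i k * delta w wt k)
             / (eta w wt e j j * delta w wt j)
      else 0)"

declare zeta.simps [simp del]

definition alpha_diag :: "real \<Rightarrow> (nat \<Rightarrow> real) \<Rightarrow> (nat \<Rightarrow> real) \<Rightarrow> nat \<Rightarrow> real \<Rightarrow> real" where
  "alpha_diag tf w wt i t =
     cosh (sqrt (delta w wt i) * (tf - t)) / cosh (sqrt (delta w wt i) * tf)"

text \<open>
  \<open>alpha tf w wt e i j\<close> is \<open>\<alpha>\<^sub>i\<close> with upper index \<open>j\<close>. The shifted equilibrium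
  trajectories \<open>z\<^sub>i = y\<^sub>i - d\<^sub>i\<close> solve a linear boundary value problem with free terminal
  value, whose solution is \<open>z\<^sub>j(t) = \<Sum>\<^sub>i \<alpha>\<^sub>i(t) z\<^sub>i(0)\<close> (upper index \<open>j\<close>). Hence the terms in
  \<open>d\<close> enter \<open>y\<^sub>j\<close> with the sign opposite to that of the terms in \<open>y(0)\<close>.
\<close>

definition alpha ::
  "real \<Rightarrow> (nat \<Rightarrow> real) \<Rightarrow> (nat \<Rightarrow> real) \<Rightarrow> (nat \<Rightarrow> real) \<Rightarrow> nat \<Rightarrow> nat \<Rightarrow> real \<Rightarrow> real" where
  "alpha tf w wt e i j t =
     (if i = j then alpha_diag tf w wt i t
      else (\<Sum>k = i..j. eta w wt e k j * zeta w wt e i k * alpha_diag tf w wt k t))"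

end

theory Submission
  imports Defs
begin

text \<open>
  In the shifted coordinates \<open>z\<^sub>i = y\<^sub>i - d\<^sub>i\<close>, stationarity of player \<open>i\<close>'s cost is the
  boundary value problem \<open>z\<^sub>i'' = \<delta>\<^sub>i z\<^sub>i + q\<^sub>i\<close>, \<open>z\<^sub>i'(t\<^sub>f) = 0\<close>, where \<open>q\<^sub>i\<close> is the weight times
  \<open>z\<close> of the predecessor. Expanding the quadratic cost around a solution, the cross term
  vanishes after an integration by parts, so any other control \<open>v\<close> costs at least
  \<open>1/2 \<integral>(v - z\<^sub>i')\<^sup>2\<close> more; hence the best response is unique. As each player only depends on
  the predecessor, the equilibrium is determined player by player. Since \<open>z'' = A z\<close>, the
  eigenvectors of \<open>A\<close> yield the explicit trajectories.
\<close>

section \<open>Integrals over subintervals and integration by parts\<close>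

text \<open>Serves to read a truncated integrand, such as a slice of a triangle in Fubini's theorem,
  as an integral over a shorter interval.\<close>

lemma integral_lebesgue_on_if:
  fixes g :: "real \<Rightarrow> real"
  assumes g: "integrable (lebesgue_on S) g" and S: "S \<in> sets lebesgue" and R: "R \<in> sets lebesgue"
  shows "(LINT s|lebesgue_on S. (if s \<in> R then g s else 0)) = integral (S \<inter> R) g"
proof -
  have "integrable (lebesgue_on S) (\<lambda>s. indicator (R \<inter> S) s *\<^sub>R g s)"
    by (rule integrable_mult_indicator[OF _ g]) (use S R in \<open>auto simp: sets_restrict_space\<close>)
  moreover have "integrable (lebesgue_on S) (\<lambda>s. indicator (R \<inter> S) s *\<^sub>R g s) \<longleftrightarrow>
      integrable (lebesgue_on S) (\<lambda>s. if s \<in> R then g s else 0)"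
    by (rule Bochner_Integration.integrable_cong) (auto simp: space_restrict_space)
  ultimately have "integrable (lebesgue_on S) (\<lambda>s. if s \<in> R then g s else 0)" by blast
  then have "(LINT s|lebesgue_on S. (if s \<in> R then g s else 0)) = integral S (\<lambda>s. if s \<in> R then g s else 0)"
    by (rule lebesgue_integral_eq_integral[OF _ S])
  also have "\<dots> = integral (S \<inter> R) g" by (simp only: integral_restrict_Int Int_commute)
  finally show ?thesis .
qed

lemma fundamental_theorem_of_calculus_subinterval:
  fixes f f' :: "real \<Rightarrow> real"
  assumes df: "\<And>t. t \<in> {a..b} \<Longrightarrow> (f has_real_derivative f' t) (at t within {a..b})"
    and le: "a \<le> r" "r \<le> s" "s \<le> b"
  shows "(f' has_integral (f s - f r)) {r..s}"
proof (rule fundamental_theorem_of_calculus[OF le(2)])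
  fix t assume t: "t \<in> {r..s}"
  have "(f has_real_derivative f' t) (at t within {r..s})"
    by (rule DERIV_subset[OF df]) (use t le in auto)
  then show "(f has_vector_derivative f' t) (at t within {r..s})"
    by (simp add: has_real_derivative_iff_has_vector_derivative)
qed

lemma id_measurable_lebesgue_on: "(\<lambda>s. s) \<in> borel_measurable (lebesgue_on {a..b::real})"
  by (rule continuous_imp_measurable_on_sets_lebesgue) auto

lemma finite_measure_lebesgue_on_Icc: "finite_measure (lebesgue_on {a..b::real})"
proof (rule finite_measure_lebesgue_on)
  show "{a..b} \<in> lmeasurable" using lmeasurable_cbox[of a b] by simp
qed

text \<open>The second factor is merely absolutely continuous, so the library rules for
  differentiable functions do not apply; Fubini's theorem replaces them.\<close>

lemma integral_by_parts_indefinite: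
  fixes f f' g :: "real \<Rightarrow> real"
  assumes g: "integrable (lebesgue_on {a..b}) g"
    and df: "\<And>t. t \<in> {a..b} \<Longrightarrow> (f has_real_derivative f' t) (at t within {a..b})"
    and cf': "continuous_on {a..b} f'"
    and fT: "f b = 0"
  shows "(LINT t|lebesgue_on {a..b}. f' t * integral {a..t} g) = - (LINT s|lebesgue_on {a..b}. f s * g s)"
proof -
  let ?M = "lebesgue_on {a..b}"
  interpret M: finite_measure ?M by (rule finite_measure_lebesgue_on_Icc)
  interpret P: pair_sigma_finite ?M ?M ..
  have [measurable]: "g \<in> borel_measurable ?M" using g by auto
  have f'i: "integrable ?M f'" by (rule continuous_imp_integrable_real[OF cf'])
  then have [measurable]: "f' \<in> borel_measurable ?M" by auto
  note [measurable] = id_measurable_lebesgue_on[of a b]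
  have int1: "integrable (?M \<Otimes>\<^sub>M ?M) (\<lambda>(s,t). g s * f' t)"
  proof (rule P.Fubini_integrable)
    show "integrable ?M (\<lambda>s. LINT t|?M. norm (case (s, t) of (s, t) \<Rightarrow> g s * f' t))"
      using g by (simp add: abs_mult)
    show "AE s in ?M. integrable ?M (\<lambda>t. case (s, t) of (s, t) \<Rightarrow> g s * f' t)"
      using f'i by simp
  qed measurable
  \<comment> \<open>\<open>F\<close> lives on the triangle s \<le> t. Integrating over s first
    produces the indefinite integral of \<open>g\<close>; integrating over t first produces the
    increment of \<open>f\<close>.\<close>
  define F where "F s t = (if s \<le> t then g s * f' t else 0)" for s t
  have intF: "integrable (?M \<Otimes>\<^sub>M ?M) (case_prod F)"
  proof (rule Bochner_Integration.integrable_bound[OF int1])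
    have [measurable]: "(\<lambda>p. fst p \<le> snd p) \<in> measurable (?M \<Otimes>\<^sub>M ?M) (count_space UNIV)"
      by measurable
    show "case_prod F \<in> borel_measurable (?M \<Otimes>\<^sub>M ?M)"
      unfolding F_def case_prod_unfold by measurable
  qed (auto simp: F_def)
  have *: "(LINT s|?M. F s t) = f' t * integral {a..t} g" if "t \<in> {a..b}" for t
  proof -
    have "(LINT s|?M. F s t) = (LINT s|?M. f' t * (if s \<in> {..t} then g s else 0))"
      by (rule Bochner_Integration.integral_cong) (auto simp: F_def)
    also have "\<dots> = f' t * integral ({a..b} \<inter> {..t}) g"
      by (simp only: integral_mult_right_zero) (subst integral_lebesgue_on_if[OF g], auto)
    also have "{a..b} \<inter> {..t} = {a..t}" using that by auto
    finally show ?thesis .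
  qed
  have **: "(LINT t|?M. F s t) = - (f s * g s)" if "s \<in> {a..b}" for s
  proof -
    have "(f' has_integral (f b - f s)) {s..b}"
      by (rule fundamental_theorem_of_calculus_subinterval[OF df]) (use that in auto)
    \<comment> \<open>The condition \<open>f b = 0\<close> removes the boundary term at
      \<open>b\<close>; at \<open>a\<close> there is none because the indefinite integral of
      \<open>g\<close> starts from zero.\<close>
    then have f's: "integral {s..b} f' = - f s" using fT by (simp add: integral_unique)
    have "(LINT t|?M. F s t) = (LINT t|?M. g s * (if t \<in> {s..} then f' t else 0))"
      by (rule Bochner_Integration.integral_cong) (auto simp: F_def)
    also have "\<dots> = g s * integral ({a..b} \<inter> {s..}) f'"
      by (simp only: integral_mult_right_zero) (subst integral_lebesgue_on_if[OF f'i], auto)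
    also have "{a..b} \<inter> {s..} = {s..b}" using that by auto
    also have "integral {s..b} f' = - f s" by (rule f's)
    finally show ?thesis by simp
  qed
  have "(LINT t|?M. f' t * integral {a..t} g) = (LINT t|?M. LINT s|?M. F s t)"
    by (rule Bochner_Integration.integral_cong) (auto simp: *)
  also have "\<dots> = (LINT s|?M. LINT t|?M. F s t)"
    by (rule P.Fubini_integral[OF intF])
  also have "\<dots> = (LINT s|?M. - (f s * g s))"
    by (rule Bochner_Integration.integral_cong) (auto simp: **)
  finally show ?thesis by simp
qed

section \<open>Square-integrable controls and their trajectories\<close>

lemma continuous_mem_L2:
  assumes "continuous_on {0..tf} u"
  shows "u \<in> L2 tf"
proof -
  have "continuous_on {0..tf} (\<lambda>t. (u t)\<^sup>2)"
    by (intro continuous_intros assms)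
  then show ?thesis
    using assms unfolding L2_def
    by (simp add: continuous_imp_integrable_real continuous_imp_measurable_on_sets_lebesgue)
qed

lemma L2_integrable:
  assumes "u \<in> L2 tf"
  shows "integrable (lebesgue_on {0..tf}) u"
proof (rule finite_measure.square_integrable_imp_integrable[OF finite_measure_lebesgue_on_Icc])
  show "u \<in> borel_measurable (lebesgue_on {0..tf})" "integrable (lebesgue_on {0..tf}) (\<lambda>t. (u t)\<^sup>2)"
    using assms unfolding L2_def by blast+
qed

lemma L2_mult_integrable:
  assumes "u \<in> L2 tf" "v \<in> L2 tf"
  shows "integrable (lebesgue_on {0..tf}) (\<lambda>t. u t * v t)"
proof (rule Bochner_Integration.integrable_bound)
  show "integrable (lebesgue_on {0..tf}) (\<lambda>t. (u t)\<^sup>2 + (v t)\<^sup>2)"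
    using assms unfolding L2_def by simp
  show "(\<lambda>t. u t * v t) \<in> borel_measurable (lebesgue_on {0..tf})"
    using assms unfolding L2_def by (intro borel_measurable_times) auto
  have "\<bar>x * y\<bar> \<le> x\<^sup>2 + y\<^sup>2" for x y :: real
  proof -
    have "2 * (\<bar>x\<bar> * \<bar>y\<bar>) \<le> x\<^sup>2 + y\<^sup>2"
      using sum_squares_bound[of "\<bar>x\<bar>" "\<bar>y\<bar>"] by (simp only: power2_abs mult.assoc)
    moreover have "0 \<le> \<bar>x\<bar> * \<bar>y\<bar>" by simp
    ultimately show ?thesis unfolding abs_mult by linarith
  qed
  then show "AE t in lebesgue_on {0..tf}. norm (u t * v t) \<le> norm ((u t)\<^sup>2 + (v t)\<^sup>2)"
    by (intro AE_I2) (simp only: real_norm_def abs_of_nonneg add_nonneg_nonneg zero_le_power2)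
qed

lemma L2_diff:
  assumes "u \<in> L2 tf" "v \<in> L2 tf"
  shows "(\<lambda>t. u t - v t) \<in> L2 tf"
proof -
  have "integrable (lebesgue_on {0..tf}) (\<lambda>t. (u t)\<^sup>2 + (v t)\<^sup>2 - 2 * (u t * v t))"
    using assms L2_mult_integrable[OF assms] unfolding L2_def by auto
  then show ?thesis
    using assms unfolding L2_def by (auto simp: power2_diff algebra_simps)
qed

lemma traj_eq_integral:
  assumes "integrable (lebesgue_on {0..tf}) u" "t \<in> {0..tf}"
  shows "traj y0 u t = y0 + integral {0..t} u"
proof -
  have "integrable (lebesgue_on {0..t}) u"
    by (rule integrable_subinterval[OF assms(1)]) (use assms in auto)
  then have "(LINT s|lebesgue_on {0..t}. u s) = integral {0..t} u"
    by (rule lebesgue_integral_eq_integral) auto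
  then show ?thesis
    unfolding traj_def set_lebesgue_integral_def by (simp add: integral_restrict_space)
qed

lemma continuous_on_traj:
  assumes "integrable (lebesgue_on {0..tf}) u"
  shows "continuous_on {0..tf} (traj y0 u)"
proof -
  have "u integrable_on {0..tf}"
    by (rule integrable_on_lebesgue_on[OF assms]) auto
  then have "continuous_on {0..tf} (\<lambda>t. y0 + integral {0..t} u)"
    by (intro continuous_intros indefinite_integral_continuous_1)
  then show ?thesis
    by (rule continuous_on_eq) (simp add: traj_eq_integral[OF assms])
qed

lemma cost_eq:
  "cost tf w wt d i y yp u =
     1 / 2 * (LINT t|lebesgue_on {0..tf}.
       w i * (y t - d i)\<^sup>2
       + (if i \<ge> 3 then wt i * ((y t - d i) + (yp t - d (i - 1)))\<^sup>2 else 0)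
       + (u t)\<^sup>2)"
proof -
  have "(LINT t:{0..tf}|lebesgue. f t) = (LINT t|lebesgue_on {0..tf}. f t)" for f :: "real \<Rightarrow> real"
    unfolding set_lebesgue_integral_def by (rule integral_restrict_space[symmetric]) simp
  then show ?thesis unfolding cost_def by simp
qed

section \<open>The boundary value problem of a single player\<close>

text \<open>Euler-Lagrange equation of one player in the shifted state, with forcing
  \<open>q\<close> from the predecessor; \<open>z' T = 0\<close> is the natural condition at a free
  terminal value. The derivative is a parameter because it is itself the control.\<close>

definition bvp :: "real \<Rightarrow> real \<Rightarrow> (real \<Rightarrow> real) \<Rightarrow> real \<Rightarrow> (real \<Rightarrow> real) \<Rightarrow> (real \<Rightarrow> real) \<Rightarrow> bool" where
  "bvp T c q z0 z z' \<longleftrightarrow>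
     (\<forall>t\<in>{0..T}. (z has_real_derivative z' t) (at t within {0..T}) \<and>
                 (z' has_real_derivative c * z t + q t) (at t within {0..T})) \<and>
     z 0 = z0 \<and> z' T = 0"

lemma bvp_continuous:
  assumes "bvp T c q z0 z z'"
  shows "continuous_on {0..T} z" "continuous_on {0..T} z'"
proof -
  show "continuous_on {0..T} z"
    using assms unfolding bvp_def by (intro DERIV_continuous_on[of _ z z']) blast
  show "continuous_on {0..T} z'"
    using assms unfolding bvp_def by (intro DERIV_continuous_on[of _ z' "\<lambda>t. c * z t + q t"]) blast
qed

lemma bvp_integral:
  assumes "bvp T c q z0 z z'" "t \<in> {0..T}"
  shows "integral {0..t} z' = z t - z0"
proof -
  have "(z' has_integral (z t - z 0)) {0..t}"
    using assms unfolding bvp_def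
    by (intro fundamental_theorem_of_calculus_subinterval[where a=0 and b=T]) auto
  then show ?thesis using assms by (simp add: bvp_def integral_unique)
qed

lemma bvp_traj:
  assumes "bvp T c q (y0 - k) z z'" "t \<in> {0..T}"
  shows "traj y0 z' t = z t + k"
proof -
  have "integrable (lebesgue_on {0..T}) z'"
    by (intro L2_integrable continuous_mem_L2 bvp_continuous(2)[OF assms(1)])
  then have "traj y0 z' t = y0 + integral {0..t} z'"
    using assms(2) by (rule traj_eq_integral)
  also have "\<dots> = z t + k" unfolding bvp_integral[OF assms] by simp
  finally show ?thesis .
qed

text \<open>Variation of constants with c = a * a: a particular solution is the integral of sinh (a
  (t - s)) q(s) / a over s from 0 to t. Since cosh (a T) is positive, the terminal condition can be
  met.\<close>

lemma bvp_exists: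
  assumes T: "T \<ge> 0" and c: "c > 0" and q: "continuous_on {0..T} q"
  obtains z z' where "bvp T c q z0 z z'"
proof -
  define a where "a = sqrt c"
  have a: "a > 0" "a * a = c" using c by (auto simp: a_def)
  \<comment> \<open>The addition theorem splits the kernel sinh (a (t - s)) into factors in t and in
    s, so that only integrals with variable upper limit, \<open>C\<close> and \<open>S\<close>, have
    to be differentiated.\<close>
  define C where "C t = integral {0..t} (\<lambda>s. cosh (a * s) * q s)" for t
  define S where "S t = integral {0..t} (\<lambda>s. sinh (a * s) * q s)" for t
  have [derivative_intros]: "(C has_real_derivative cosh (a * t) * q t) (at t within {0..T})"
      "(S has_real_derivative sinh (a * t) * q t) (at t within {0..T})" if "t \<in> {0..T}" for t
    unfolding C_def[abs_def] S_def[abs_def]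
    by (rule integral_has_real_derivative; (intro continuous_intros q that)?)+
  have pyth: "cosh (a * t) * cosh (a * t) = 1 + sinh (a * t) * sinh (a * t)" for t
    using cosh_square_eq[of "a * t"] by (simp add: power2_eq_square)
  \<comment> \<open>\<open>B\<close> solves \<open>z' T = 0\<close>, which is linear in
    \<open>B\<close> with coefficient \<open>a * cosh (a * T)\<close>.\<close>
  define B where "B = - (cosh (a * T) * C T - sinh (a * T) * S T + a * z0 * sinh (a * T)) / (a * cosh (a * T))"
  define z where "z t = (sinh (a * t) * C t - cosh (a * t) * S t) / a + z0 * cosh (a * t) + B * sinh (a * t)" for t
  define z' where "z' t = cosh (a * t) * C t - sinh (a * t) * S t + a * z0 * sinh (a * t) + a * B * cosh (a * t)" for t
  have "bvp T c q z0 z z'"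
    unfolding bvp_def
  proof (intro conjI ballI)
    fix t assume t: "t \<in> {0..T}"
    have "(z has_real_derivative
        (a * cosh (a * t) * C t + sinh (a * t) * (cosh (a * t) * q t)
          - (a * sinh (a * t) * S t + cosh (a * t) * (sinh (a * t) * q t))) / a
        + z0 * (a * sinh (a * t)) + B * (a * cosh (a * t))) (at t within {0..T})"
      unfolding z_def[abs_def]
      by (rule derivative_eq_intros t refl | simp add: less_imp_neq[OF a(1), symmetric] mult_ac)+
    moreover have "(a * cosh (a * t) * C t + sinh (a * t) * (cosh (a * t) * q t)
          - (a * sinh (a * t) * S t + cosh (a * t) * (sinh (a * t) * q t))) / a
        + z0 * (a * sinh (a * t)) + B * (a * cosh (a * t)) = z' t"
      unfolding z'_def using a(1) by (simp add: field_simps)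
    ultimately show "(z has_real_derivative z' t) (at t within {0..T})" by simp
    have "(z' has_real_derivative
        a * sinh (a * t) * C t + cosh (a * t) * (cosh (a * t) * q t)
        - (a * cosh (a * t) * S t + sinh (a * t) * (sinh (a * t) * q t))
        + a * z0 * (a * cosh (a * t)) + a * B * (a * sinh (a * t))) (at t within {0..T})"
      unfolding z'_def[abs_def]
      by (rule derivative_eq_intros t refl | simp add: less_imp_neq[OF a(1), symmetric] mult_ac)+
    moreover have "a * sinh (a * t) * C t + cosh (a * t) * (cosh (a * t) * q t)
        - (a * cosh (a * t) * S t + sinh (a * t) * (sinh (a * t) * q t))
        + a * z0 * (a * cosh (a * t)) + a * B * (a * sinh (a * t)) = c * z t + q t"
    proof -
      have "cosh (a * t) * (cosh (a * t) * q t) = q t + sinh (a * t) * (sinh (a * t) * q t)"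
        using arg_cong[OF pyth[of t], of "\<lambda>x. x * q t"] by (simp add: algebra_simps)
      moreover have "c * z t = a * (sinh (a * t) * C t - cosh (a * t) * S t) 
         + a * a * z0 * cosh (a * t) + a * a * B * sinh (a * t)"
        unfolding z_def a(2)[symmetric] using a(1) by (simp add: field_simps)
      ultimately show ?thesis by (simp add: algebra_simps)
    qed
    ultimately show "(z' has_real_derivative c * z t + q t) (at t within {0..T})" by simp
  next
    show "z 0 = z0" by (simp add: z_def C_def S_def)
    show "z' T = 0" using a cosh_real_pos[of "a*T"] by (simp add: z'_def B_def field_simps)
  qed
  then show thesis using that by blast
qed

lemma bvp_cong:
  assumes "bvp T c q z0 z z'" "\<And>t. t \<in> {0..T} \<Longrightarrow> q t = q' t"
  shows "bvp T c q' z0 z z'"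
  using assms unfolding bvp_def by simp

section \<open>Cost excess and best responses\<close>

text \<open>The excess term is kept explicit so that one inequality yields both optimality of
  \<open>z'\<close>, as the excess is nonnegative, and its uniqueness almost everywhere, when the
  excess is zero.\<close>

lemma cost_excess:
  assumes yp: "i \<ge> 3 \<Longrightarrow> continuous_on {0..tf} yp"
    and nonneg: "delta w wt i \<ge> 0"
    and bvp: "bvp tf (delta w wt i) (\<lambda>t. if i \<ge> 3 then wt i * (yp t - d (i - 1)) else 0) (y0 - d i) z z'"
    and v: "v \<in> L2 tf"
  shows "cost tf w wt d i (traj y0 z') yp z' + 1 / 2 * (LINT t|lebesgue_on {0..tf}. (v t - z' t)\<^sup>2)
    \<le> cost tf w wt d i (traj y0 v) yp v"
proof -
  let ?M = "lebesgue_on {0..tf}"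
  define q where "q t = (if i \<ge> 3 then wt i * (yp t - d (i - 1)) else 0)" for t
  define c where "c = delta w wt i"
  have bvp': "bvp tf c q (y0 - d i) z z'" using bvp unfolding q_def[abs_def] c_def .
  have cz: "continuous_on {0..tf} z" and cz': "continuous_on {0..tf} z'"
    using bvp_continuous[OF bvp] by blast+
  have cq: "continuous_on {0..tf} q"
    unfolding q_def[abs_def] using yp by (cases "i \<ge> 3") (auto intro!: continuous_intros)
  have z'L2: "z' \<in> L2 tf" by (rule continuous_mem_L2[OF cz'])
  \<comment> \<open>\<open>g\<close> is the deviation of the control and \<open>h\<close> the
    deviation of the state that it causes; \<open>h\<close> starts at zero since the initial value
    is shared.\<close>
  define g where "g t = v t - z' t" for t
  have gL2: "g \<in> L2 tf" unfolding g_def[abs_def] by (rule L2_diff[OF v z'L2])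
  have gi: "integrable ?M g" by (rule L2_integrable[OF gL2])
  define h where "h t = integral {0..t} g" for t
  have ch: "continuous_on {0..tf} h"
    unfolding h_def[abs_def]
    by (intro indefinite_integral_continuous_1 integrable_on_lebesgue_on[OF gi]) auto
  have tz: "traj y0 z' t = z t + d i" if "t \<in> {0..tf}" for t
    by (rule bvp_traj[OF bvp' that])
  have tv: "traj y0 v t = z t + h t + d i" if "t \<in> {0..tf}" for t
  proof -
    have s: "{0..t} \<subseteq> {0..tf}" using that by auto
    have "v integrable_on {0..t}" "z' integrable_on {0..t}"
      by (auto intro!: integrable_on_subinterval[OF integrable_on_lebesgue_on[OF L2_integrable] s] v z'L2)
    then have "h t = integral {0..t} v - integral {0..t} z'"
      unfolding h_def g_def[abs_def] by (rule Henstock_Kurzweil_Integration.integral_diff)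
    then show ?thesis
      using traj_eq_integral[OF L2_integrable[OF v] that, of y0] bvp_integral[OF bvp' that] by simp
  qed
  define F where "F t = w i * (z t)\<^sup>2
      + (if i \<ge> 3 then wt i * (z t + (yp t - d (i - 1)))\<^sup>2 else 0) + (z' t)\<^sup>2" for t
  have "continuous_on {0..tf} F"
    unfolding F_def[abs_def] using yp cz cz' by (cases "i \<ge> 3") (auto intro!: continuous_intros)
  then have Fi: "integrable ?M F" by (rule continuous_imp_integrable_real)
  have i1: "integrable ?M (\<lambda>t. (c * z t + q t) * h t)"
    by (intro continuous_imp_integrable_real continuous_intros cz cq ch)
  have i2: "integrable ?M (\<lambda>t. z' t * g t)"
    by (rule L2_mult_integrable[OF z'L2 gL2])
  have i3: "integrable ?M (\<lambda>t. c * (h t)\<^sup>2)"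
    by (intro continuous_imp_integrable_real continuous_intros ch)
  have i4: "integrable ?M (\<lambda>t. (g t)\<^sup>2)"
    using gL2 unfolding L2_def by blast
  \<comment> \<open>By parts with \<open>z'\<close> in the role of \<open>f\<close>: its derivative
    is \<open>c * z t + q t\<close> and it vanishes at \<open>tf\<close>. This cancels the linear
    part of the expansion below.\<close>
  have stationary: "(LINT t|?M. (c * z t + q t) * h t) = - (LINT t|?M. z' t * g t)"
    unfolding h_def
    by (rule integral_by_parts_indefinite[OF gi])
      (use bvp' in \<open>auto simp: bvp_def intro!: continuous_intros cz cq\<close>)
  have costz: "cost tf w wt d i (traj y0 z') yp z' = 1 / 2 * (LINT t|?M. F t)"
  proof -
    have "(LINT t|?M. w i * (traj y0 z' t - d i)\<^sup>2
       + (if i \<ge> 3 then wt i * ((traj y0 z' t - d i) + (yp t - d (i - 1)))\<^sup>2 else 0)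
       + (z' t)\<^sup>2) = (LINT t|?M. F t)"
      by (rule Bochner_Integration.integral_cong) (simp_all add: F_def tz)
    then show ?thesis unfolding cost_eq by simp
  qed
  \<comment> \<open>The expansion is exact: the weights of the squared state terms add up to
    \<open>c\<close>, and the coupling to the predecessor enters the linear part through
    \<open>q\<close>.\<close>
  have costv: "cost tf w wt d i (traj y0 v) yp v = 1 / 2 *
     (LINT t|?M. F t + 2 * ((c * z t + q t) * h t + z' t * g t) + c * (h t)\<^sup>2 + (g t)\<^sup>2)"
  proof -
    have "(LINT t|?M. w i * (traj y0 v t - d i)\<^sup>2
       + (if i \<ge> 3 then wt i * ((traj y0 v t - d i) + (yp t - d (i - 1)))\<^sup>2 else 0)
       + (v t)\<^sup>2) = 
      (LINT t|?M. F t + 2 * ((c * z t + q t) * h t + z' t * g t) + c * (h t)\<^sup>2 + (g t)\<^sup>2)"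
    proof (rule Bochner_Integration.integral_cong)
      fix t assume "t \<in> space ?M"
      then have t: "t \<in> {0..tf}" by simp
      have v: "v t = z' t + g t" by (simp add: g_def)
      show "w i * (traj y0 v t - d i)\<^sup>2
        + (if i \<ge> 3 then wt i * ((traj y0 v t - d i) + (yp t - d (i - 1)))\<^sup>2 else 0)
        + (v t)\<^sup>2 =
        F t + 2 * ((c * z t + q t) * h t + z' t * g t) + c * (h t)\<^sup>2 + (g t)\<^sup>2"
        unfolding v F_def q_def c_def delta_def tv[OF t]
        by (simp add: power2_eq_square algebra_simps)
    qed simp
    then show ?thesis unfolding cost_eq by simp
  qed
  have "(LINT t|?M. F t + 2 * ((c * z t + q t) * h t + z' t * g t) + c * (h t)\<^sup>2 + (g t)\<^sup>2)
      = (LINT t|?M. F t) + (LINT t|?M. c * (h t)\<^sup>2) + (LINT t|?M. (g t)\<^sup>2)"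
    using Fi i1 i2 i3 i4 by (simp add: stationary)
  moreover have "(LINT t|?M. c * (h t)\<^sup>2) \<ge> 0"
    by (rule Bochner_Integration.integral_nonneg) (use nonneg in \<open>simp add: c_def\<close>)
  ultimately show ?thesis unfolding costz costv g_def by simp
qed

text \<open>Each control is stationary against the actual trajectory of the predecessor, so the cost
  excess rules out a profitable unilateral deviation.\<close>

lemma nash_equilibriumI:
  assumes nonneg: "\<And>i. i \<in> {1..n} \<Longrightarrow> delta w wt i \<ge> 0"
    and bvp: "\<And>i. i \<in> {1..n} \<Longrightarrow> bvp tf (delta w wt i)
      (\<lambda>t. if i \<ge> 3 then wt i * (traj (y0 (i - 1)) (u (i - 1)) t - d (i - 1)) else 0)
      (y0 i - d i) (z i) (u i)"
  shows "nash_equilibrium n tf w wt d y0 u"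
proof -
  have L2: "u i \<in> L2 tf" if "i \<in> {1..n}" for i
    by (rule continuous_mem_L2[OF bvp_continuous(2)[OF bvp[OF that]]])
  have "player_cost tf w wt d y0 i u \<le> player_cost tf w wt d y0 i (u(i := v))"
    if i: "i \<in> {1..n}" and v: "v \<in> L2 tf" for i v
  proof -
    have "continuous_on {0..tf} (traj (y0 (i - 1)) (u (i - 1)))" if "i \<ge> 3"
      by (rule continuous_on_traj[OF L2_integrable[OF L2]]) (use i that in auto)
    from cost_excess[OF this nonneg[OF i] bvp[OF i] v]
    have "cost tf w wt d i (traj (y0 i) (u i)) (traj (y0 (i - 1)) (u (i - 1))) (u i)
        + 1 / 2 * (LINT t|lebesgue_on {0..tf}. (v t - u i t)\<^sup>2)
      \<le> cost tf w wt d i (traj (y0 i) v) (traj (y0 (i - 1)) (u (i - 1))) v" by blast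
    moreover have "(LINT t|lebesgue_on {0..tf}. (v t - u i t)\<^sup>2) \<ge> 0"
      by (rule Bochner_Integration.integral_nonneg) simp
    ultimately have "cost tf w wt d i (traj (y0 i) (u i)) (traj (y0 (i - 1)) (u (i - 1))) (u i)
      \<le> cost tf w wt d i (traj (y0 i) v) (traj (y0 (i - 1)) (u (i - 1))) v" by linarith
    \<comment> \<open>For i \<ge> 1 truncated subtraction yields an index other than
      \<open>i\<close>, so a deviation of player \<open>i\<close> leaves the predecessor's control
      unchanged.\<close>
    moreover have "i - 1 \<noteq> i" using i by auto
    ultimately show ?thesis unfolding player_cost_def by simp
  qed
  with L2 show ?thesis unfolding nash_equilibrium_def by blast
qed

text \<open>Testing the equilibrium against the deviation \<open>z'\<close> makes the cost excess at
  most zero, which forces the squared distance of the controls to vanish.\<close>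

lemma nash_equilibrium_best_response:
  assumes nash: "nash_equilibrium n tf w wt d y0 u"
    and i: "i \<in> {1..n}" and nonneg: "delta w wt i \<ge> 0"
    and bvp: "bvp tf (delta w wt i)
      (\<lambda>t. if i \<ge> 3 then wt i * (traj (y0 (i - 1)) (u (i - 1)) t - d (i - 1)) else 0)
      (y0 i - d i) z z'"
  shows "AE t in lebesgue_on {0..tf}. u i t = z' t"
    and "t \<in> {0..tf} \<Longrightarrow> traj (y0 i) (u i) t = z t + d i"
proof -
  let ?M = "lebesgue_on {0..tf}"
  have L2: "u j \<in> L2 tf" if "j \<in> {1..n}" for j
    using nash that unfolding nash_equilibrium_def by blast
  have z'L2: "z' \<in> L2 tf"
    by (rule continuous_mem_L2[OF bvp_continuous(2)[OF bvp]])
  have "continuous_on {0..tf} (traj (y0 (i - 1)) (u (i - 1)))" if "i \<ge> 3"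
    by (rule continuous_on_traj[OF L2_integrable[OF L2]]) (use i that in auto)
  from cost_excess[OF this nonneg bvp L2[OF i]]
  have "cost tf w wt d i (traj (y0 i) z') (traj (y0 (i - 1)) (u (i - 1))) z'
      + 1 / 2 * (LINT t|?M. (u i t - z' t)\<^sup>2)
    \<le> cost tf w wt d i (traj (y0 i) (u i)) (traj (y0 (i - 1)) (u (i - 1))) (u i)" by blast
  moreover have "player_cost tf w wt d y0 i u \<le> player_cost tf w wt d y0 i (u(i := z'))"
    using nash i z'L2 unfolding nash_equilibrium_def by blast
  moreover have "i - 1 \<noteq> i" using i by auto
  ultimately have le: "(LINT t|?M. (u i t - z' t)\<^sup>2) \<le> 0"
    unfolding player_cost_def by simp
  have int: "integrable ?M (\<lambda>t. (u i t - z' t)\<^sup>2)"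
    using L2_diff[OF L2[OF i] z'L2] unfolding L2_def by blast
  have "(LINT t|?M. (u i t - z' t)\<^sup>2) \<ge> 0"
    by (rule Bochner_Integration.integral_nonneg) simp
  with le have "(LINT t|?M. (u i t - z' t)\<^sup>2) = 0" by simp
  then have "AE t in ?M. (u i t - z' t)\<^sup>2 = 0"
    using integral_nonneg_eq_0_iff_AE[OF int] by simp
  then show ae: "AE t in ?M. u i t = z' t" by simp
  assume t: "t \<in> {0..tf}"
  have ui: "integrable ?M (u i)" and zi: "integrable ?M z'"
    using L2_integrable[OF L2[OF i]] L2_integrable[OF z'L2] by blast+
  have eq: "{0..tf} \<inter> {..t} = {0..t}" using t by auto
  have m: "(\<lambda>s. if s \<in> {..t} then f s else 0) \<in> borel_measurable ?M"
    if "integrable ?M f" for f :: "real \<Rightarrow> real"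
  proof (rule measurable_If_set)
    show "f \<in> borel_measurable ?M" using that by (rule borel_measurable_integrable)
    show "{..t} \<inter> space ?M \<in> sets ?M" by (auto simp: sets_restrict_space)
  qed simp
  \<comment> \<open>Truncation at \<open>t\<close> turns both indefinite integrals into integrals
    over the whole interval, where equality almost everywhere applies; hence the trajectories agree
    at every time.\<close>
  have "(LINT s|?M. (if s \<in> {..t} then u i s else 0)) = (LINT s|?M. (if s \<in> {..t} then z' s else 0))"
    by (rule integral_cong_AE[OF m[OF ui] m[OF zi]]) (use ae in eventually_elim, simp)
  moreover have "(LINT s|?M. (if s \<in> {..t} then f s else 0)) = integral {0..t} f"
    if "integrable ?M f" for f :: "real \<Rightarrow> real"
    using integral_lebesgue_on_if[OF that, of "{..t}"] unfolding eq by simp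
  ultimately have "integral {0..t} (u i) = integral {0..t} z'"
    using ui zi by simp
  then have "traj (y0 i) (u i) t = traj (y0 i) z' t"
    using traj_eq_integral[OF ui t] traj_eq_integral[OF zi t] by simp
  also have "\<dots> = z t + d i" by (rule bvp_traj[OF bvp t])
  finally show "traj (y0 i) (u i) t = z t + d i" .
qed

section \<open>Chains of boundary value problems and equilibria\<close>

text \<open>The system z'' = A z row by row; rows 1 and 2 have no subdiagonal entry. The length
  \<open>m\<close> is kept apart from the number of players so that the formula for player
  \<open>i\<close> can rest on the first \<open>i\<close> rows alone.\<close>

definition bvp_chain :: "nat \<Rightarrow> real \<Rightarrow> (nat \<Rightarrow> real) \<Rightarrow> (nat \<Rightarrow> real) \<Rightarrow> (nat \<Rightarrow> real) \<Rightarrow>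
    (nat \<Rightarrow> real \<Rightarrow> real) \<Rightarrow> (nat \<Rightarrow> real \<Rightarrow> real) \<Rightarrow> bool" where
  "bvp_chain m T w wt z0 z z' \<longleftrightarrow> (\<forall>i\<in>{1..m}. bvp T (delta w wt i)
     (\<lambda>t. if i \<ge> 3 then wt i * z (i - 1) t else 0) (z0 i) (z i) (z' i))"

text \<open>Induction along the chain: once the predecessor's trajectory is known to be
  \<open>z\<close> shifted by \<open>d\<close>, the player faces exactly the next problem of the
  chain, whose solution is the only best response.\<close>

lemma nash_equilibrium_bvp_chain:
  assumes nash: "nash_equilibrium n tf w wt d y0 u"
    and nonneg: "\<And>i. i \<in> {1..n} \<Longrightarrow> delta w wt i \<ge> 0"
    and chain: "bvp_chain m tf w wt (\<lambda>i. y0 i - d i) z z'" and m: "m \<le> n"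
    and i: "i \<in> {1..m}"
  shows "(AE t in lebesgue_on {0..tf}. u i t = z' i t) \<and>
    (\<forall>t\<in>{0..tf}. traj (y0 i) (u i) t = z i t + d i)"
  using i
proof (induction i)
  case (Suc j)
  have "bvp tf (delta w wt (Suc j))
      (\<lambda>t. if Suc j \<ge> 3 then wt (Suc j) * (traj (y0 (Suc j - 1)) (u (Suc j - 1)) t - d (Suc j - 1)) else 0)
      (y0 (Suc j) - d (Suc j)) (z (Suc j)) (z' (Suc j))"
  proof (rule bvp_cong)
    show "bvp tf (delta w wt (Suc j))
      (\<lambda>t. if Suc j \<ge> 3 then wt (Suc j) * z (Suc j - 1) t else 0) (y0 (Suc j) - d (Suc j)) (z (Suc j)) (z' (Suc j))"
      using chain Suc.prems unfolding bvp_chain_def by blast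
    fix t assume "t \<in> {0..tf}"
    with Suc show "(if Suc j \<ge> 3 then wt (Suc j) * z (Suc j - 1) t else 0) =
       (if Suc j \<ge> 3 then wt (Suc j) * (traj (y0 (Suc j - 1)) (u (Suc j - 1)) t - d (Suc j - 1)) else 0)"
      by auto
  qed
  moreover have "Suc j \<in> {1..n}" using Suc.prems m by auto
  ultimately show ?case
    using nash_equilibrium_best_response[OF nash _ nonneg] by blast
qed simp

lemma bvp_chain_nash:
  assumes nonneg: "\<And>i. i \<in> {1..n} \<Longrightarrow> delta w wt i \<ge> 0"
    and chain: "bvp_chain n tf w wt (\<lambda>i. y0 i - d i) z u"
  shows "nash_equilibrium n tf w wt d y0 u"
proof (rule nash_equilibriumI[OF nonneg])
  fix i assume i: "i \<in> {1..n}"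
  have b: "bvp tf (delta w wt j) (\<lambda>t. if j \<ge> 3 then wt j * z (j - 1) t else 0) (y0 j - d j) (z j) (u j)"
    if "j \<in> {1..n}" for j using chain that unfolding bvp_chain_def by blast
  show "bvp tf (delta w wt i)
      (\<lambda>t. if i \<ge> 3 then wt i * (traj (y0 (i - 1)) (u (i - 1)) t - d (i - 1)) else 0)
      (y0 i - d i) (z i) (u i)"
  proof (rule bvp_cong[OF b[OF i]])
    fix t assume t: "t \<in> {0..tf}"
    have "traj (y0 (i - 1)) (u (i - 1)) t = z (i - 1) t + d (i - 1)" if "i \<ge> 3"
      by (rule bvp_traj[OF b t]) (use i that in auto)
    then show "(if i \<ge> 3 then wt i * z (i - 1) t else 0) =
      (if i \<ge> 3 then wt i * (traj (y0 (i - 1)) (u (i - 1)) t - d (i - 1)) else 0)" by simp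
  qed
qed

text \<open>The solutions are built player by player by dependent choice: \<open>P\<close> carries
  the continuity that makes a solution admissible as the next forcing, \<open>Q\<close> links
  consecutive players.\<close>

lemma bvp_chain_exists:
  assumes T: "T \<ge> 0" and pos: "\<And>i. i \<in> {1..n} \<Longrightarrow> delta w wt i > 0"
  obtains z z' where "bvp_chain n T w wt z0 z z'"
proof -
  define P where "P = (\<lambda>(i::nat) (f :: (real \<Rightarrow> real) \<times> (real \<Rightarrow> real)). continuous_on {0..T} (fst f))"
  define Q where "Q = (\<lambda>(i::nat) (f :: (real \<Rightarrow> real) \<times> (real \<Rightarrow> real)) (f' :: (real \<Rightarrow> real) \<times> (real \<Rightarrow> real)). Suc i \<in> {1..n} \<longrightarrow>
     bvp T (delta w wt (Suc i)) (\<lambda>t. if Suc i \<ge> 3 then wt (Suc i) * fst f t else 0)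
      (z0 (Suc i)) (fst f') (snd f'))"
  have "\<exists>F. \<forall>i. P i (F i) \<and> Q i (F i) (F (Suc i))"
  proof (rule dependent_nat_choice)
    \<comment> \<open>Index 0 is a dummy: the problem of player 1 has zero forcing and does not read
      it.\<close>
    show "\<exists>f. P 0 f" by (rule exI[of _ "(\<lambda>_. 0, \<lambda>_. 0)"]) (simp add: P_def)
    fix f i assume f: "P i f"
    show "\<exists>f'. P (Suc i) f' \<and> Q i f f'"
    proof (cases "Suc i \<in> {1..n}")
      case True
      have "continuous_on {0..T} (\<lambda>t. if Suc i \<ge> 3 then wt (Suc i) * fst f t else 0)"
        using f unfolding P_def by (cases "Suc i \<ge> 3") (auto intro!: continuous_intros)
      then obtain y y' where "bvp T (delta w wt (Suc i))
          (\<lambda>t. if Suc i \<ge> 3 then wt (Suc i) * fst f t else 0) (z0 (Suc i)) y y'"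
        by (rule bvp_exists[OF T pos[OF True]])
      with bvp_continuous(1)[OF this] show ?thesis
        by (intro exI[of _ "(y, y')"]) (simp add: P_def Q_def)
    next
      case False
      then show ?thesis
        by (intro exI[of _ "(\<lambda>_. 0, \<lambda>_. 0)"]) (simp add: P_def Q_def)
    qed
  qed
  then obtain F where F: "\<And>i. Q i (F i) (F (Suc i))" by blast
  have "bvp_chain n T w wt z0 (\<lambda>i. fst (F i)) (\<lambda>i. snd (F i))"
    unfolding bvp_chain_def
  proof
    fix i assume i: "i \<in> {1..n}"
    then obtain j where j: "i = Suc j" by (cases i) auto
    from F[of j] i show "bvp T (delta w wt i) (\<lambda>t. if i \<ge> 3 then wt i * fst (F (i - 1)) t else 0)
       (z0 i) (fst (F i)) (snd (F i))" unfolding j diff_Suc_1 by (simp add: Q_def)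
  qed
  then show thesis using that by blast
qed

section \<open>Eigenvectors of the coupling matrix\<close>

lemma eta_diag: "eta w wt e i i = e i"
  by (subst eta.simps) simp

lemma eta_below: "j < i \<Longrightarrow> eta w wt e i j = 0"
  by (subst eta.simps) simp

lemma zeta_below: "j < i \<Longrightarrow> zeta w wt e i j = 0"
  by (subst zeta.simps) simp

text \<open>Row \<open>j\<close> of A v = \<delta> v for the \<open>k\<close>-th column of V. Below
  the diagonal it is the recursion cleared of its denominator, whence the distinctness; on the
  diagonal the entry at \<open>j - 1\<close> is zero.\<close>

lemma eta_eigenvector:
  assumes "3 \<le> j" "2 \<le> k" "k \<le> j" "k < j \<Longrightarrow> delta w wt j \<noteq> delta w wt k"
  shows "delta w wt k * eta w wt e k j = delta w wt j * eta w wt e k j + wt j * eta w wt e k (j - 1)"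
proof (cases "k = j")
  case True
  then show ?thesis using assms by (simp add: eta_below)
next
  case False
  then have "eta w wt e k j = - (wt j * eta w wt e k (j - 1)) / (delta w wt j - delta w wt k)"
    using assms by (subst eta.simps) (simp add: delta_def)
  moreover have "delta w wt j - delta w wt k \<noteq> 0" using assms False by simp
  ultimately have "eta w wt e k j * (delta w wt j - delta w wt k) = - (wt j * eta w wt e k (j - 1))"
    by simp
  then show ?thesis by (simp add: algebra_simps)
qed

text \<open>Write \<open>V\<close> and \<open>Z\<close> for the matrices of \<open>eta\<close> and \<open>zeta\<close>. The left-hand side is the entry of
  \<open>V diag(\<delta>) Z\<close> in row \<open>j\<close> and column \<open>i\<close>, the right-hand side that of \<open>A\<close>.\<close>

lemma eta_delta_zeta:
  assumes "2 \<le> i" "2 \<le> j" "e i \<noteq> 0" "e j \<noteq> 0" "delta w wt j \<noteq> 0"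
  shows "(\<Sum>k = 2..j. delta w wt k * (eta w wt e k j * zeta w wt e i k)) =
    (if j = i then delta w wt j else if j = i + 1 then wt j else 0)"
proof (cases "j < i")
  case True
  then have "(\<Sum>k = 2..j. delta w wt k * (eta w wt e k j * zeta w wt e i k)) = 0"
    by (intro sum.neutral) (auto simp: zeta_below)
  then show ?thesis using True by simp
next
  case False
  let ?s = "\<lambda>k. delta w wt k * (eta w wt e k j * zeta w wt e i k)"
  have "(\<Sum>k = 2..j. ?s k) = (\<Sum>k = i..j. ?s k)"
    using assms False by (intro sum.mono_neutral_right) (auto simp: zeta_below)
  also have "\<dots> = (\<Sum>k = i..<j. ?s k) + ?s j"
    using False by (simp add: sum.last_plus add.commute)
  also have "\<dots> = (if j = i then delta w wt j else if j = i + 1 then wt j else 0)"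
  proof -
    \<comment> \<open>The cases are the clauses of \<open>zeta\<close>: each clause is this very
      equation solved for the last summand.\<close>
    consider "j = i" | "j = i + 1" | "i + 2 \<le> j" using False by linarith
    then show ?thesis
    proof cases
      case 1
      then show ?thesis using assms by (subst zeta.simps) (simp add: eta_diag)
    next
      case 2
      have "zeta w wt e i j = (wt j - eta w wt e i j * zeta w wt e i i * delta w wt i)
             / (eta w wt e j j * delta w wt j)"
        using 2 assms by (subst zeta.simps) simp
      then have "zeta w wt e i j * (eta w wt e j j * delta w wt j)
          = wt j - eta w wt e i j * zeta w wt e i i * delta w wt i"
        using assms by (simp add: eta_diag)
      moreover have "{i..<j} = {i}" using 2 by auto
      ultimately show ?thesis using 2 by (simp add: algebra_simps)
    next
      case 3
      have "zeta w wt e i j = - (\<Sum>k = i..<j. eta w wt e k j * zeta w wt e i k * delta w wt k)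
             / (eta w wt e j j * delta w wt j)"
        using 3 assms by (subst zeta.simps) simp
      then have "zeta w wt e i j * (eta w wt e j j * delta w wt j)
          = - (\<Sum>k = i..<j. eta w wt e k j * zeta w wt e i k * delta w wt k)"
        using assms by (simp add: eta_diag)
      also have "(\<Sum>k = i..<j. eta w wt e k j * zeta w wt e i k * delta w wt k) = (\<Sum>k = i..<j. ?s k)"
        by (intro sum.cong) (auto simp: mult_ac)
      finally show ?thesis using 3 by (simp add: algebra_simps)
    qed
  qed
  finally show ?thesis .
qed

text \<open>With \<open>W = V Z\<close>, the eigenvector equations give \<open>A W = V diag(\<delta>) Z = A\<close>, which is
  solved for \<open>W\<close> row by row.\<close>

lemma eta_zeta_inverse:
  assumes e: "\<And>k. k \<in> {2..m} \<Longrightarrow> e k \<noteq> 0"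
    and nz: "\<And>k. k \<in> {2..m} \<Longrightarrow> delta w wt k \<noteq> 0"
    and inj: "inj_on (delta w wt) {2..m}"
    and i: "i \<in> {2..m}" and j: "2 \<le> j" "j \<le> m"
  shows "(\<Sum>k = 2..j. eta w wt e k j * zeta w wt e i k) = (if i = j then 1 else 0)"
  using j
proof (induction j rule: dec_induct)
  case base
  \<comment> \<open>Row 2 of A has only its diagonal entry, so dividing by it gives row 2 of
    W.\<close>
  have "delta w wt 2 * (eta w wt e 2 2 * zeta w wt e i 2) = (if 2 = i then delta w wt 2 else 0)"
    using eta_delta_zeta[of i 2 e w wt] i base e nz by (auto split: if_splits)
  then show ?case using nz[of 2] base by (auto split: if_splits)
next
  case (step j)
  let ?J = "Suc j"
  have J: "?J \<in> {2..m}" using step by auto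
  have "delta w wt k * (eta w wt e k ?J * zeta w wt e i k) =
      delta w wt ?J * (eta w wt e k ?J * zeta w wt e i k) + wt ?J * (eta w wt e k j * zeta w wt e i k)"
    if "k \<in> {2..?J}" for k
  proof -
    have "delta w wt ?J \<noteq> delta w wt k" if "k < ?J"
      using inj_onD[OF inj, of ?J k] that \<open>k \<in> {2..?J}\<close> J by auto
    then have "delta w wt k * eta w wt e k ?J = delta w wt ?J * eta w wt e k ?J + wt ?J * eta w wt e k j"
      using eta_eigenvector[of ?J k w wt e] that step by auto
    from arg_cong[OF this, of "\<lambda>x. x * zeta w wt e i k"] show ?thesis
      by (simp add: algebra_simps)
  qed
  then have "(\<Sum>k = 2..?J. delta w wt k * (eta w wt e k ?J * zeta w wt e i k)) =
      delta w wt ?J * (\<Sum>k = 2..?J. eta w wt e k ?J * zeta w wt e i k)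
      + wt ?J * (\<Sum>k = 2..?J. eta w wt e k j * zeta w wt e i k)"
    by (simp add: sum.distrib sum_distrib_left del: sum.cl_ivl_Suc)
  \<comment> \<open>The summand \<open>k = ?J\<close> is zero by triangularity, which leaves row
    \<open>j\<close> of W, known by induction.\<close>
  moreover have "(\<Sum>k = 2..?J. eta w wt e k j * zeta w wt e i k) = (if i = j then 1 else 0)"
    using step by (simp add: eta_below)
  moreover have "(\<Sum>k = 2..?J. delta w wt k * (eta w wt e k ?J * zeta w wt e i k)) =
      (if ?J = i then delta w wt ?J else if ?J = i + 1 then wt ?J else 0)"
    using i J by (intro eta_delta_zeta e nz) auto
  \<comment> \<open>The subdiagonal entry \<open>wt ?J\<close> occurs on both sides exactly when
    \<open>i = j\<close>, and cancels.\<close>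
  ultimately have "delta w wt ?J * (\<Sum>k = 2..?J. eta w wt e k ?J * zeta w wt e i k)
      = (if i = ?J then delta w wt ?J else 0)"
    by (auto simp del: sum.cl_ivl_Suc split: if_splits)
  then show ?case using nz[OF J] by (auto simp del: sum.cl_ivl_Suc split: if_splits)
qed

section \<open>Explicit solution as a superposition of modes\<close>

text \<open>Merges the two clauses of \<open>alpha\<close>: on the diagonal the sum collapses to
  \<open>k = i\<close>, where \<open>eta\<close> and \<open>zeta\<close> are reciprocal.\<close>

lemma alpha_eq_sum:
  assumes "2 \<le> i" "i \<le> j" "e i \<noteq> 0"
  shows "alpha tf w wt e i j t = (\<Sum>k = 2..j. eta w wt e k j * zeta w wt e i k * alpha_diag tf w wt k t)"
proof -
  have "(\<Sum>k = 2..j. eta w wt e k j * zeta w wt e i k * alpha_diag tf w wt k t)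
     = (\<Sum>k = i..j. eta w wt e k j * zeta w wt e i k * alpha_diag tf w wt k t)"
    using assms by (intro sum.mono_neutral_right) (auto simp: zeta_below)
  moreover have "eta w wt e i i * zeta w wt e i i = 1"
    using assms by (subst zeta.simps) (simp add: eta_diag)
  ultimately show ?thesis unfolding alpha_def by auto
qed

text \<open>These unforced modes with unit initial value are the building blocks of the explicit
  solution.\<close>

lemma bvp_alpha_diag:
  assumes "delta w wt i \<ge> 0"
  shows "bvp T (delta w wt i) (\<lambda>_. 0) 1 (alpha_diag T w wt i)
    (\<lambda>t. - sqrt (delta w wt i) * sinh (sqrt (delta w wt i) * (T - t)) / cosh (sqrt (delta w wt i) * T))"
proof -
  define a where "a = sqrt (delta w wt i)"
  have a: "delta w wt i = a * a" using assms by (simp add: a_def)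
  have c: "cosh (a * T) \<noteq> 0" using cosh_real_pos[of "a * T"] by linarith
  have "((\<lambda>t. cosh (a * (T - t)) / cosh (a * T)) has_real_derivative
      - a * sinh (a * (T - t)) / cosh (a * T)) (at t within {0..T})" for t
    by (rule derivative_eq_intros refl | simp add: c)+
  moreover have "((\<lambda>t. - a * sinh (a * (T - t)) / cosh (a * T)) has_real_derivative
      a * a * (cosh (a * (T - t)) / cosh (a * T)) + 0) (at t within {0..T})" for t
    by (rule derivative_eq_intros refl | simp add: c)+
  ultimately show ?thesis
    unfolding bvp_def alpha_diag_def[abs_def] a_def[symmetric] unfolding a using c by simp
qed

lemma bvp_cmult:
  assumes "bvp T c q z0 z z'"
  shows "bvp T c (\<lambda>t. r * q t) (r * z0) (\<lambda>t. r * z t) (\<lambda>t. r * z' t)"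
proof -
  have "((\<lambda>t. r * z' t) has_real_derivative c * (r * z t) + r * q t) (at t within {0..T})"
    if "t \<in> {0..T}" for t
  proof -
    have "((\<lambda>t. r * z' t) has_real_derivative r * (c * z t + q t)) (at t within {0..T})"
      using assms that unfolding bvp_def by (intro DERIV_cmult) blast
    then show ?thesis by (simp add: algebra_simps)
  qed
  then show ?thesis using assms unfolding bvp_def by (auto intro: DERIV_cmult)
qed

text \<open>Expanding the initial vector in eigenvectors of A decouples the chain; each mode then
  evolves by its own \<open>alpha_diag\<close>. Component 1 stands apart because A does not couple
  it to the others.\<close>

lemma bvp_chain_alpha:
  assumes e: "\<And>k. k \<in> {1..m} \<Longrightarrow> e k \<noteq> 0"
    and pos: "\<And>k. k \<in> {1..m} \<Longrightarrow> delta w wt k > 0"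
    and inj: "inj_on (delta w wt) {2..m}"
  shows "\<exists>z'. bvp_chain m T w wt z0
    (\<lambda>j t. if j = 1 then alpha_diag T w wt 1 t * z0 1 else \<Sum>i = 2..j. alpha T w wt e i j t * z0 i) z'"
proof -
  \<comment> \<open>The coordinates Z z0 of the initial vector in the basis of eigenvectors.\<close>
  define b where "b k = (\<Sum>i = 2..k. zeta w wt e i k * z0 i)" for k
  let ?A = "alpha_diag T w wt"
  have rep: "(\<Sum>i = 2..j. alpha T w wt e i j t * z0 i) = (\<Sum>k = 2..j. eta w wt e k j * b k * ?A k t)"
    if j: "j \<in> {2..m}" for j t
  proof -
    have "(\<Sum>i = 2..j. alpha T w wt e i j t * z0 i) =
        (\<Sum>i = 2..j. \<Sum>k = 2..j. eta w wt e k j * zeta w wt e i k * ?A k t * z0 i)"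
      using j e by (intro sum.cong) (auto simp: alpha_eq_sum sum_distrib_right)
    also have "\<dots> = (\<Sum>k = 2..j. \<Sum>i = 2..j. eta w wt e k j * zeta w wt e i k * ?A k t * z0 i)"
      by (rule sum.swap)
    also have "\<dots> = (\<Sum>k = 2..j. \<Sum>i = 2..k. eta w wt e k j * zeta w wt e i k * ?A k t * z0 i)"
      by (intro sum.cong sum.mono_neutral_right) (auto simp: zeta_below)
    also have "\<dots> = (\<Sum>k = 2..j. eta w wt e k j * b k * ?A k t)"
      unfolding b_def by (simp add: sum_distrib_left sum_distrib_right mult_ac)
    finally show ?thesis .
  qed
  \<comment> \<open>This is V (Z z0) = z0, from V Z being the identity; it gives the initial values,
    as every mode equals 1 at time 0.\<close>
  have init: "(\<Sum>k = 2..j. eta w wt e k j * b k) = z0 j" if j: "j \<in> {2..m}" for j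
  proof -
    have "(\<Sum>k = 2..j. eta w wt e k j * b k) =
        (\<Sum>k = 2..j. \<Sum>i = 2..k. eta w wt e k j * zeta w wt e i k * z0 i)"
      unfolding b_def by (simp add: sum_distrib_left mult_ac)
    also have "\<dots> = (\<Sum>k = 2..j. \<Sum>i = 2..j. eta w wt e k j * zeta w wt e i k * z0 i)"
      by (intro sum.cong sum.mono_neutral_left) (auto simp: zeta_below)
    also have "\<dots> = (\<Sum>i = 2..j. \<Sum>k = 2..j. eta w wt e k j * zeta w wt e i k * z0 i)"
      by (rule sum.swap)
    also have "\<dots> = (\<Sum>i = 2..j. (if i = j then 1 else 0) * z0 i)"
    proof (rule sum.cong)
      fix i assume i: "i \<in> {2..j}"
      have "(\<Sum>k = 2..j. eta w wt e k j * zeta w wt e i k) = (if i = j then 1 else 0)"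
      proof (rule eta_zeta_inverse[OF _ _ inj])
        fix k assume "k \<in> {2..m}"
        then have "k \<in> {1..m}" by auto
        then show "e k \<noteq> 0" "delta w wt k \<noteq> 0" using e[of k] pos[of k] by auto
      qed (use i j in auto)
      then show "(\<Sum>k = 2..j. eta w wt e k j * zeta w wt e i k * z0 i) = (if i = j then 1 else 0) * z0 i"
        by (simp only: sum_distrib_right[symmetric])
    qed simp
    also have "\<dots> = (\<Sum>i = 2..j. if i = j then z0 i else 0)" by (intro sum.cong) auto
    also have "\<dots> = z0 j" using j by simp
    finally show ?thesis .
  qed
  have "\<exists>D'. bvp T (delta w wt k) (\<lambda>_. 0) 1 (?A k) D'" if "k \<in> {1..m}" for k
    using bvp_alpha_diag[OF less_imp_le[OF pos[OF that]]] by blast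
  then obtain D where D: "\<And>k. k \<in> {1..m} \<Longrightarrow> bvp T (delta w wt k) (\<lambda>_. 0) 1 (?A k) (D k)"
    by meson
  let ?z = "\<lambda>j t. if j = 1 then ?A 1 t * z0 1 else \<Sum>i = 2..j. alpha T w wt e i j t * z0 i"
  define z' where "z' j t = (if j = 1 then z0 1 * D 1 t else \<Sum>k = 2..j. eta w wt e k j * b k * D k t)"
    for j t
  have "bvp_chain m T w wt z0 ?z z'"
    unfolding bvp_chain_def
  proof
    fix j assume j: "j \<in> {1..m}"
    show "bvp T (delta w wt j) (\<lambda>t. if 3 \<le> j then wt j * ?z (j - 1) t else 0) (z0 j) (?z j) (z' j)"
    proof (cases "j = 1")
      case True
      have "bvp T (delta w wt 1) (\<lambda>_. z0 1 * 0) (z0 1 * 1) (\<lambda>t. z0 1 * ?A 1 t) (\<lambda>t. z0 1 * D 1 t)"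
        using True j by (intro bvp_cmult D) auto
      then show ?thesis unfolding True z'_def[abs_def] by (simp add: mult.commute)
    next
      case False
      then have j2: "j \<in> {2..m}" using j by auto
      have z: "?z j = (\<lambda>t. \<Sum>k = 2..j. eta w wt e k j * b k * ?A k t)"
        using False rep[OF j2] by simp
      have z': "z' j = (\<lambda>t. \<Sum>k = 2..j. eta w wt e k j * b k * D k t)"
        using False by (simp add: z'_def[abs_def])
      have Dk: "(?A k has_real_derivative D k t) (at t within {0..T})"
          "(D k has_real_derivative delta w wt k * ?A k t) (at t within {0..T})"
        if "k \<in> {2..j}" "t \<in> {0..T}" for k t
        using D[of k] that j unfolding bvp_def by auto
      have ini: "?A k 0 = 1" "D k T = 0" if "k \<in> {2..j}" for k
        using D[of k] that j unfolding bvp_def by auto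
      show ?thesis
        unfolding bvp_def z z'
      proof (intro conjI ballI)
        fix t assume t: "t \<in> {0..T}"
        show "((\<lambda>t. \<Sum>k = 2..j. eta w wt e k j * b k * ?A k t) has_real_derivative
          (\<Sum>k = 2..j. eta w wt e k j * b k * D k t)) (at t within {0..T})"
          by (intro DERIV_sum DERIV_cmult Dk t)
        have "((\<lambda>t. \<Sum>k = 2..j. eta w wt e k j * b k * D k t) has_real_derivative
          (\<Sum>k = 2..j. eta w wt e k j * b k * (delta w wt k * ?A k t))) (at t within {0..T})"
          by (intro DERIV_sum DERIV_cmult Dk t)
        \<comment> \<open>The second derivative multiplies mode \<open>k\<close> by its eigenvalue;
          the eigenvector equation trades these factors for row \<open>j\<close> of A.\<close>
        moreover have "(\<Sum>k = 2..j. eta w wt e k j * b k * (delta w wt k * ?A k t)) =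
          delta w wt j * (\<Sum>k = 2..j. eta w wt e k j * b k * ?A k t) +
          (if 3 \<le> j then wt j * ?z (j - 1) t else 0)"
        proof (cases "3 \<le> j")
          case True
          have j1: "j - 1 \<in> {2..m}" and jeq: "Suc (j - 1) = j" using True j by auto
          have "eta w wt e k j * b k * (delta w wt k * ?A k t) =
              delta w wt j * (eta w wt e k j * b k * ?A k t)
              + wt j * (eta w wt e k (j - 1) * b k * ?A k t)" if k: "k \<in> {2..j}" for k
          proof -
            have "delta w wt j \<noteq> delta w wt k" if "k < j"
              using inj_onD[OF inj, of j k] that k j by auto
            then have "delta w wt k * eta w wt e k j =
                delta w wt j * eta w wt e k j + wt j * eta w wt e k (j - 1)"
              using eta_eigenvector[of j k w wt e] True k by auto
            from arg_cong[OF this, of "\<lambda>x. x * (b k * ?A k t)"] show ?thesis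
              by (simp add: algebra_simps)
          qed
          then have "(\<Sum>k = 2..j. eta w wt e k j * b k * (delta w wt k * ?A k t)) =
            delta w wt j * (\<Sum>k = 2..j. eta w wt e k j * b k * ?A k t)
            + wt j * (\<Sum>k = 2..j. eta w wt e k (j - 1) * b k * ?A k t)"
            by (simp add: sum.distrib sum_distrib_left)
          \<comment> \<open>Mode \<open>j\<close> has no component at \<open>j - 1\<close>, so the
            sum is the predecessor's trajectory.\<close>
          also have "(\<Sum>k = 2..j. eta w wt e k (j - 1) * b k * ?A k t) =
              (\<Sum>k = 2..j - 1. eta w wt e k (j - 1) * b k * ?A k t)"
            using True by (intro sum.mono_neutral_right) (auto simp: eta_below)
          also have "\<dots> = ?z (j - 1) t" using rep[OF j1, of t] True by simp
          finally show ?thesis using True by simp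
        next
          case False
          then have "j = 2" using j2 by auto
          then show ?thesis by simp
        qed
        ultimately show "((\<lambda>t. \<Sum>k = 2..j. eta w wt e k j * b k * D k t) has_real_derivative
          delta w wt j * (\<Sum>k = 2..j. eta w wt e k j * b k * ?A k t) +
          (if 3 \<le> j then wt j * ?z (j - 1) t else 0)) (at t within {0..T})" by simp
      next
        show "(\<Sum>k = 2..j. eta w wt e k j * b k * ?A k 0) = z0 j"
          using init[OF j2] ini(1) by simp
        show "(\<Sum>k = 2..j. eta w wt e k j * b k * D k T) = 0"
          using ini(2) by simp
      qed
    qed
  qed
  then show ?thesis by blast
qed

section \<open>Existence, uniqueness and equilibrium trajectories\<close>

text \<open>Distinctness of the \<delta> is attached to the explicit formula, where
  \<open>eta\<close> divides by their differences. For player \<open>i\<close> it is asked on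
  \<open>{2..i}\<close>: the modes 2 to \<open>i\<close> are the ones that reach row
  \<open>i\<close>, and index 1 is decoupled.\<close>

theorem theorem2:
  fixes n :: nat and tf :: real and w wt d x y0 :: "nat \<Rightarrow> real"
  assumes n: "n \<ge> 1"
    and tf: "tf > 0"
    and w: "\<And>i. i \<in> {1..n} \<Longrightarrow> w i > 0"
    and d: "\<And>i. i \<in> {1..n} \<Longrightarrow> d i < 0"
    and wt: "\<And>i. i \<in> {3..n} \<Longrightarrow> wt i > 0"
    and x: "\<And>i. i \<in> {1..n} \<Longrightarrow> x (i - 1) > x i"
    and y0: "\<And>i. i \<in> {1..n} \<Longrightarrow> y0 i = x i - x (i - 1)"
  shows
    "(\<exists>u. nash_equilibrium n tf w wt d y0 u \<and>
        (\<forall>v. nash_equilibrium n tf w wt d y0 v \<longrightarrow>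
           (\<forall>i\<in>{1..n}. AE t in lebesgue_on {0..tf}. v i t = u i t)))
     \<and>
     (\<forall>u e. nash_equilibrium n tf w wt d y0 u \<longrightarrow> (\<forall>i\<in>{1..n}. e i \<noteq> 0) \<longrightarrow>
        (\<forall>i\<in>{1..n}. inj_on (delta w wt) {2..i} \<longrightarrow>
           (\<forall>t\<in>{0..tf}.
              traj (y0 i) (u i) t =
                (if i \<le> 2
                 then alpha tf w wt e i i t * y0 i - (alpha tf w wt e i i t - 1) * d i
                 else (\<Sum>k = 2..i. alpha tf w wt e k i t * y0 k)
                      - (\<Sum>k = 2..i - 1. alpha tf w wt e k i t * d k)
                      - (alpha tf w wt e i i t - 1) * d i))))"
proof -
  have pos: "delta w wt i > 0" if "i \<in> {1..n}" for i
    using w[of i] wt[of i] that by (auto simp: delta_def)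
  then have nonneg: "delta w wt i \<ge> 0" if "i \<in> {1..n}" for i
    using that less_imp_le by blast
  have existence: "\<exists>u. nash_equilibrium n tf w wt d y0 u \<and>
        (\<forall>v. nash_equilibrium n tf w wt d y0 v \<longrightarrow>
           (\<forall>i\<in>{1..n}. AE t in lebesgue_on {0..tf}. v i t = u i t))"
  proof -
    \<comment> \<open>One fixed chain gives an equilibrium, and every other equilibrium is compared
      with it.\<close>
    obtain z u where chain: "bvp_chain n tf w wt (\<lambda>i. y0 i - d i) z u"
      using bvp_chain_exists[of tf n w wt] tf pos less_imp_le by blast
    show ?thesis
      using bvp_chain_nash[OF nonneg chain] nash_equilibrium_bvp_chain[OF _ nonneg chain order_refl]
      by blast
  qed
  have formula: "traj (y0 i) (u i) t =
                (if i \<le> 2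
                 then alpha tf w wt e i i t * y0 i - (alpha tf w wt e i i t - 1) * d i
                 else (\<Sum>k = 2..i. alpha tf w wt e k i t * y0 k)
                      - (\<Sum>k = 2..i - 1. alpha tf w wt e k i t * d k)
                      - (alpha tf w wt e i i t - 1) * d i)"
    if nash: "nash_equilibrium n tf w wt d y0 u" and e: "\<forall>i\<in>{1..n}. e i \<noteq> 0"
      and i: "i \<in> {1..n}" and inj: "inj_on (delta w wt) {2..i}" and t: "t \<in> {0..tf}"
    for u e i t
  proof -
    \<comment> \<open>The chain is cut off at player \<open>i\<close>, matching the range on which
      the \<delta> are distinct.\<close>
    have "\<exists>z'. bvp_chain i tf w wt (\<lambda>i. y0 i - d i)
      (\<lambda>j t. if j = 1 then alpha_diag tf w wt 1 t * (y0 1 - d 1)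
        else \<Sum>i = 2..j. alpha tf w wt e i j t * (y0 i - d i)) z'"
      using e i by (intro bvp_chain_alpha pos inj) auto
    then obtain z' where "bvp_chain i tf w wt (\<lambda>i. y0 i - d i)
      (\<lambda>j t. if j = 1 then alpha_diag tf w wt 1 t * (y0 1 - d 1)
        else \<Sum>i = 2..j. alpha tf w wt e i j t * (y0 i - d i)) z'" by blast
    from nash_equilibrium_bvp_chain[OF nash nonneg this, of i] i t
    have eq: "traj (y0 i) (u i) t = (if i = 1 then alpha_diag tf w wt 1 t * (y0 1 - d 1)
        else \<Sum>k = 2..i. alpha tf w wt e k i t * (y0 k - d k)) + d i" by simp
    consider "i = 1" | "i = 2" | "i \<ge> 3" using i by force
    then show ?thesis
    proof cases
      case 1
      then show ?thesis unfolding eq by (simp add: alpha_def algebra_simps)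
    next
      case 2
      then show ?thesis unfolding eq by (simp add: algebra_simps)
    next
      case 3
      \<comment> \<open>The last summand is split off because it combines with the shift back by
        \<open>d i\<close> into the term with \<open>alpha - 1\<close>.\<close>
      then have "(\<Sum>k = 2..i. alpha tf w wt e k i t * d k)
          = (\<Sum>k = 2..i - 1. alpha tf w wt e k i t * d k) + alpha tf w wt e i i t * d i"
        by (cases i) auto
      with 3 show ?thesis unfolding eq by (simp add: right_diff_distrib sum_subtractf left_diff_distrib)
    qed
  qed
  show ?thesis using existence formula by blast
qed

end
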